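(* Let $A$ be a constant with $0<A\le 2$, and let $G:\mathbb{R}\to\mathbb{R}$ be a smooth function satisfying $G>0$, $G'<0$ and $G\,G''\le A\,(G')^2$. Let $u:\mathbb{R}^2\to\mathbb{R}$ be a smooth convex solution of $\Delta u=G(u)$ in $\mathbb{R}^2$. If the function $x\mapsto \det(D^2u(x))$ has a local minimum at some point of $\mathbb{R}^2$, then $\det(D^2u)=0$ everywhere in $\mathbb{R}^2$.
   Context: $D^2u$ denotes the Hessian matrix of $u$, and $\Delta u$ its trace. $G'$ and $G''$ denote the first and second derivatives of the one-variable function $G$. A local minimum is not assumed to be strict. *)

theory Defs
  imports "HOL-Analysis.Analysis"
begin

(* C^k on the whole space, by recursion on k through all directional derivatives. On a
   finite-dimensional domain this is the usual notion: f is C^(k+1) iff f is differentiable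
   and its directional derivatives, equivalently its partial derivatives, are C^k. *)
primrec Ck :: "nat \<Rightarrow> ('a::euclidean_space \<Rightarrow> real) \<Rightarrow> bool" where
  "Ck 0 f \<longleftrightarrow> continuous_on UNIV f"
| "Ck (Suc k) f \<longleftrightarrow> (\<forall>x. f differentiable (at x)) \<and>
     (\<forall>v. Ck k (\<lambda>x. frechet_derivative f (at x) v))"

definition smooth :: "('a::euclidean_space \<Rightarrow> real) \<Rightarrow> bool" where
  "smooth f \<longleftrightarrow> (\<forall>k. Ck k f)"

(* frechet_derivative is a Hilbert choice, meaningful only where f is differentiable;
   likewise for the notions built on it below. *)
definition partial_deriv :: "'n::finite \<Rightarrow> (real^'n \<Rightarrow> real) \<Rightarrow> real^'n \<Rightarrow> real" where
  "partial_deriv i f x = frechet_derivative f (at x) (axis i 1)"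

definition hessian :: "(real^'n::finite \<Rightarrow> real) \<Rightarrow> real^'n \<Rightarrow> real^'n^'n" where
  "hessian f x = (\<chi> i j. partial_deriv i (partial_deriv j f) x)"

definition laplacian :: "(real^'n::finite \<Rightarrow> real) \<Rightarrow> real^'n \<Rightarrow> real" where
  "laplacian f x = trace (hessian f x)"

definition local_min_at :: "('a::topological_space \<Rightarrow> real) \<Rightarrow> 'a \<Rightarrow> bool" where
  "local_min_at f x \<longleftrightarrow> (\<forall>\<^sub>F y in nhds x. f x \<le> f y)"

end

theory Submission
  imports Defs
begin

text \<open>
  Write \<open>p, q, r\<close> for the second derivatives \<open>u\<^sub>1\<^sub>1, u\<^sub>1\<^sub>2, u\<^sub>2\<^sub>2\<close> and \<open>J = p r - q\<^sup>2\<close> for the Hessian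
  determinant; convexity gives \<open>J \<ge> 0\<close>. The equation \<open>p + r = G(u)\<close>, differentiated once, leaves only
  two unknown third derivatives at each point, \<open>b = u\<^sub>1\<^sub>1\<^sub>2\<close> and \<open>c = u\<^sub>1\<^sub>2\<^sub>2\<close>. The two components of
  \<open>\<nabla>J\<close> are a linear system for \<open>b\<close> and \<open>c\<close> whose determinant is the discriminant
  \<open>D = (p - r)\<^sup>2 + 4 q\<^sup>2 = G(u)\<^sup>2 - 4 J\<close>, the squared difference of the Hessian eigenvalues. Multiplying
  \<open>\<Delta>J\<close> by \<open>D\<close> therefore eliminates the third derivatives altogether
  (\<open>discriminant_laplacian_J\<close>):

  \<open>D \<Delta>J = 2 G' J D + Q (G'' D - 2 G (G')\<^sup>2) + L \<bullet> \<nabla>J - 4 |\<nabla>J|\<^sup>2\<close>,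

  where \<open>Q = r u\<^sub>1\<^sup>2 - 2 q u\<^sub>1 u\<^sub>2 + p u\<^sub>2\<^sup>2\<close> is nonnegative by convexity and \<open>L\<close> is a continuous vector
  field. Since \<open>0 \<le> D \<le> G\<^sup>2\<close>, the condition \<open>G G'' \<le> A (G')\<^sup>2 \<le> 2 (G')\<^sup>2\<close> makes the second term nonpositive, so
  that \<open>D \<Delta>J \<le> 2 G' J D + L \<bullet> \<nabla>J\<close> (\<open>differential_inequality\<close>).

  Suppose \<open>J\<close> has a local minimum, so that \<open>\<nabla>J = 0\<close> and \<open>\<Delta>J \<ge> 0\<close> there. If \<open>J\<close> were positive at that
  point, the first term would be strictly negative because \<open>G' < 0\<close>, a contradiction when \<open>D > 0\<close>;
  when \<open>D = 0\<close>, the vanishing of \<open>\<nabla>J\<close> forces \<open>\<nabla>u = 0\<close>, and the formula for \<open>\<Delta>J\<close> itself gives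
  \<open>\<Delta>J < 0\<close>. Hence \<open>J\<close> vanishes at the point (\<open>J_zero_at_local_min\<close>), and \<open>0\<close> is the global minimum
  of \<open>J\<close>.

  It remains to propagate this zero. We have \<open>D \<Delta>J \<le> L \<bullet> \<nabla>J\<close> with \<open>J \<ge> 0\<close>, and the coefficient \<open>D\<close>,
  which may vanish elsewhere, equals \<open>G\<^sup>2 > 0\<close> on the zero set of \<open>J\<close>. The strong minimum principle in
  this slightly degenerate form (\<open>strong_minimum_principle\<close>) follows from Hopf's Gaussian barrier:
  the comparison only ever uses the inequality at points where \<open>J\<close> is small.
\<close>

section \<open>Directional and partial derivatives\<close>

abbreviation dir_deriv :: "'a::euclidean_space \<Rightarrow> ('a \<Rightarrow> real) \<Rightarrow> 'a \<Rightarrow> real" where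
  "dir_deriv v f \<equiv> \<lambda>x. frechet_derivative f (at x) v"

lemma partial_deriv_eq_dir_deriv: "partial_deriv i f = dir_deriv (axis i 1) f"
  by (simp add: partial_deriv_def fun_eq_iff)

lemma smooth_imp_differentiable: "smooth f \<Longrightarrow> f differentiable (at x)"
  unfolding smooth_def by (metis Ck.simps(2))

lemma smooth_imp_continuous_on: "smooth f \<Longrightarrow> continuous_on S f"
  unfolding smooth_def by (metis Ck.simps(1) continuous_on_subset subset_UNIV)

lemma smooth_dir_deriv: "smooth f \<Longrightarrow> smooth (dir_deriv v f)"
  unfolding smooth_def by (metis Ck.simps(2))

lemma smooth_partial_deriv: "smooth f \<Longrightarrow> smooth (partial_deriv i f)"
  by (simp add: partial_deriv_eq_dir_deriv smooth_dir_deriv)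

lemma has_real_derivative_along_line:
  fixes f :: "'a::euclidean_space \<Rightarrow> real"
  assumes "f differentiable (at (x + t *\<^sub>R v))"
  shows "((\<lambda>t. f (x + t *\<^sub>R v)) has_real_derivative dir_deriv v f (x + t *\<^sub>R v)) (at t)"
proof -
  have f: "(f has_derivative frechet_derivative f (at (x + t *\<^sub>R v))) (at (x + t *\<^sub>R v))"
    using assms frechet_derivative_works by blast
  have "((\<lambda>t. x + t *\<^sub>R v) has_derivative (\<lambda>h. h *\<^sub>R v)) (at t)"
    by (auto intro!: derivative_eq_intros)
  from has_derivative_compose[OF this f]
  show ?thesis
    by (rule has_derivative_imp_has_field_derivative)
       (simp add: linear_scale[OF has_derivative_linear[OF f]])
qed

text \<open>
  The mean value theorem is applied first in direction \<open>v\<close> to the difference of \<open>f\<close> along two parallel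
  segments, then in direction \<open>w\<close> to the derivative so obtained. Because the left-hand side is
  symmetric in \<open>v\<close> and \<open>w\<close>, this yields the symmetry of second derivatives.
\<close>

lemma second_difference_mean_value:
  fixes f :: "'a::euclidean_space \<Rightarrow> real"
  assumes f: "\<And>x. f differentiable (at x)" and f': "\<And>x. dir_deriv v f differentiable (at x)"
    and t: "0 < t"
  obtains \<theta> \<eta> where "0 < \<theta>" "\<theta> < t" "0 < \<eta>" "\<eta> < t"
    "f (x + t *\<^sub>R v + t *\<^sub>R w) - f (x + t *\<^sub>R v) - f (x + t *\<^sub>R w) + f x
      = t\<^sup>2 * dir_deriv w (dir_deriv v f) (x + \<theta> *\<^sub>R v + \<eta> *\<^sub>R w)"
proof -
  let ?\<phi> = "\<lambda>s. f ((x + t *\<^sub>R w) + s *\<^sub>R v) - f (x + s *\<^sub>R v)"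
  have "\<And>s. (?\<phi> has_real_derivative
      dir_deriv v f ((x + t *\<^sub>R w) + s *\<^sub>R v) - dir_deriv v f (x + s *\<^sub>R v)) (at s)"
    by (intro DERIV_diff has_real_derivative_along_line f)
  from MVT2[OF t this] obtain \<theta> where \<theta>: "0 < \<theta>" "\<theta> < t" and
    1: "?\<phi> t - ?\<phi> 0 = t * (dir_deriv v f ((x + t *\<^sub>R w) + \<theta> *\<^sub>R v) - dir_deriv v f (x + \<theta> *\<^sub>R v))"
    by auto
  have "\<And>s. ((\<lambda>s. dir_deriv v f ((x + \<theta> *\<^sub>R v) + s *\<^sub>R w)) has_real_derivative
      dir_deriv w (dir_deriv v f) ((x + \<theta> *\<^sub>R v) + s *\<^sub>R w)) (at s)"
    by (rule has_real_derivative_along_line[OF f'])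
  from MVT2[OF t this] obtain \<eta> where \<eta>: "0 < \<eta>" "\<eta> < t" and
    2: "dir_deriv v f ((x + \<theta> *\<^sub>R v) + t *\<^sub>R w) - dir_deriv v f (x + \<theta> *\<^sub>R v)
       = t * dir_deriv w (dir_deriv v f) ((x + \<theta> *\<^sub>R v) + \<eta> *\<^sub>R w)"
    by auto
  have "f (x + t *\<^sub>R v + t *\<^sub>R w) - f (x + t *\<^sub>R v) - f (x + t *\<^sub>R w) + f x = ?\<phi> t - ?\<phi> 0"
    by (simp add: add_ac)
  also have "\<dots> = t * (t * dir_deriv w (dir_deriv v f) (x + \<theta> *\<^sub>R v + \<eta> *\<^sub>R w))"
    unfolding 1 using 2 by (simp add: add_ac)
  finally show ?thesis
    using that \<theta> \<eta> by (simp add: power2_eq_square)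
qed

text \<open>
  Schwarz's theorem: both mixed derivatives, at points arbitrarily close to \<open>x\<close>, equal the same
  second difference quotient.
\<close>

lemma dir_deriv_commute:
  fixes f :: "'a::euclidean_space \<Rightarrow> real"
  assumes "Ck 2 f"
  shows "dir_deriv v (dir_deriv w f) = dir_deriv w (dir_deriv v f)"
proof
  fix x
  have f: "f differentiable (at x)" and f': "dir_deriv v f differentiable (at x)"
    and cont: "continuous_on UNIV (dir_deriv w (dir_deriv v f))" for x v w
    using assms by (auto simp: numeral_2_eq_2)
  show "dir_deriv v (dir_deriv w f) x = dir_deriv w (dir_deriv v f) x" (is "?a x = ?b x")
  proof (rule ccontr)
    assume "?a x \<noteq> ?b x"
    define e where "e = \<bar>?a x - ?b x\<bar> / 2"
    have e: "e > 0" using \<open>?a x \<noteq> ?b x\<close> by (simp add: e_def)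
    obtain d1 where d1: "d1 > 0" "\<And>y. dist y x < d1 \<Longrightarrow> dist (?a y) (?a x) < e"
      using cont e unfolding continuous_on_iff by (metis UNIV_I)
    obtain d2 where d2: "d2 > 0" "\<And>y. dist y x < d2 \<Longrightarrow> dist (?b y) (?b x) < e"
      using cont e unfolding continuous_on_iff by (metis UNIV_I)
    \<comment> \<open>small enough that every point of the parallelogram spanned by \<open>t v\<close> and \<open>t w\<close> at \<open>x\<close>
      lies in both neighbourhoods\<close>
    define t where "t = min d1 d2 / (norm v + norm w + 1)"
    have t: "t > 0" using d1 d2 by (auto simp: t_def intro!: divide_pos_pos add_nonneg_pos)
    have near: "dist (x + \<theta> *\<^sub>R v + \<eta> *\<^sub>R w) x < min d1 d2"
      if "0 < \<theta>" "\<theta> < t" "0 < \<eta>" "\<eta> < t" for \<theta> \<eta>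
    proof -
      have "dist (x + \<theta> *\<^sub>R v + \<eta> *\<^sub>R w) x \<le> \<theta> * norm v + \<eta> * norm w"
        using norm_triangle_ineq[of "\<theta> *\<^sub>R v" "\<eta> *\<^sub>R w"] that by (simp add: dist_norm add.assoc)
      also have "\<dots> \<le> t * norm v + t * norm w"
        using that by (intro add_mono mult_right_mono) auto
      also have "\<dots> < t * (norm v + norm w + 1)"
        using t by (simp add: algebra_simps)
      also have "\<dots> = min d1 d2"
        using add_nonneg_pos[of "norm v + norm w" 1] by (simp add: t_def)
      finally show ?thesis .
    qed
    obtain \<theta> \<eta> where p: "0 < \<theta>" "\<theta> < t" "0 < \<eta>" "\<eta> < t" and
      1: "f (x + t *\<^sub>R v + t *\<^sub>R w) - f (x + t *\<^sub>R v) - f (x + t *\<^sub>R w) + f x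
        = t\<^sup>2 * ?b (x + \<theta> *\<^sub>R v + \<eta> *\<^sub>R w)"
      by (rule second_difference_mean_value[OF f f' t])
    obtain \<theta>' \<eta>' where q: "0 < \<theta>'" "\<theta>' < t" "0 < \<eta>'" "\<eta>' < t" and
      2: "f (x + t *\<^sub>R w + t *\<^sub>R v) - f (x + t *\<^sub>R w) - f (x + t *\<^sub>R v) + f x
        = t\<^sup>2 * ?a (x + \<theta>' *\<^sub>R w + \<eta>' *\<^sub>R v)"
      by (rule second_difference_mean_value[OF f f' t])
    have "t\<^sup>2 * ?b (x + \<theta> *\<^sub>R v + \<eta> *\<^sub>R w) = t\<^sup>2 * ?a (x + \<eta>' *\<^sub>R v + \<theta>' *\<^sub>R w)"
      using 1 2 by (simp add: algebra_simps)
    then have eq: "?b (x + \<theta> *\<^sub>R v + \<eta> *\<^sub>R w) = ?a (x + \<eta>' *\<^sub>R v + \<theta>' *\<^sub>R w)"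
      using t by simp
    show False
      using d2(2)[of "x + \<theta> *\<^sub>R v + \<eta> *\<^sub>R w"] d1(2)[of "x + \<eta>' *\<^sub>R v + \<theta>' *\<^sub>R w"]
        near[OF p] near[OF q(3,4,1,2)] eq
      by (simp add: dist_real_def e_def abs_if split: if_splits)
  qed
qed

lemma partial_deriv_commute:
  "smooth f \<Longrightarrow> partial_deriv i (partial_deriv j f) = partial_deriv j (partial_deriv i f)"
  unfolding partial_deriv_eq_dir_deriv by (rule dir_deriv_commute) (simp add: smooth_def)

lemma laplacian_eq_sum: "laplacian f x = (\<Sum>i\<in>UNIV. partial_deriv i (partial_deriv i f) x)"
  by (simp add: laplacian_def hessian_def trace_def)

section \<open>The Laplacian\<close>

text \<open>
  This is the regularity that the minimum principle needs, and it passes to products more directly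
  than smoothness does.
\<close>

definition twice_differentiable :: "(real^'n::finite \<Rightarrow> real) \<Rightarrow> bool" where
  "twice_differentiable f \<longleftrightarrow>
    (\<forall>x. f differentiable (at x)) \<and> (\<forall>i x. partial_deriv i f differentiable (at x))"

lemma smooth_imp_twice_differentiable: "smooth f \<Longrightarrow> twice_differentiable f"
  by (simp add: twice_differentiable_def smooth_imp_differentiable smooth_partial_deriv)

lemma
  assumes f: "f differentiable (at x)" and g: "g differentiable (at x)"
  shows partial_deriv_add:
      "partial_deriv i (\<lambda>x. f x + g x) x = partial_deriv i f x + partial_deriv i g x"
    and partial_deriv_diff:
      "partial_deriv i (\<lambda>x. f x - g x) x = partial_deriv i f x - partial_deriv i g x"
    and partial_deriv_mult:
      "partial_deriv i (\<lambda>x. f x * g x) x = f x * partial_deriv i g x + partial_deriv i f x * g x"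
proof -
  note f' = f[unfolded frechet_derivative_works] and g' = g[unfolded frechet_derivative_works]
  show "partial_deriv i (\<lambda>x. f x + g x) x = partial_deriv i f x + partial_deriv i g x"
    unfolding partial_deriv_def frechet_derivative_at[OF has_derivative_add[OF f' g'], symmetric] ..
  show "partial_deriv i (\<lambda>x. f x - g x) x = partial_deriv i f x - partial_deriv i g x"
    unfolding partial_deriv_def frechet_derivative_at[OF has_derivative_diff[OF f' g'], symmetric] ..
  show "partial_deriv i (\<lambda>x. f x * g x) x = f x * partial_deriv i g x + partial_deriv i f x * g x"
    unfolding partial_deriv_def frechet_derivative_at[OF has_derivative_mult[OF f' g'], symmetric] ..
qed

lemma partial_deriv_compose:
  fixes G :: "real \<Rightarrow> real"
  assumes G: "G differentiable (at (f x))" and f: "f differentiable (at x)"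
  shows "partial_deriv i (\<lambda>x. G (f x)) x = deriv G (f x) * partial_deriv i f x"
proof -
  have "(G has_derivative (*) (deriv G (f x))) (at (f x))"
    using G DERIV_deriv_iff_real_differentiable[of G "f x"] by (simp add: has_field_derivative_def)
  from has_derivative_compose[OF f[unfolded frechet_derivative_works] this]
  show ?thesis
    unfolding partial_deriv_def by (simp flip: frechet_derivative_at)
qed

lemma partial_deriv_sum:
  assumes "\<And>k. k \<in> K \<Longrightarrow> f k differentiable (at x)"
  shows "partial_deriv i (\<lambda>x. \<Sum>k\<in>K. f k x) x = (\<Sum>k\<in>K. partial_deriv i (f k) x)"
proof -
  have "((\<lambda>x. \<Sum>k\<in>K. f k x) has_derivative (\<lambda>h. \<Sum>k\<in>K. frechet_derivative (f k) (at x) h)) (at x)"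
    using assms by (intro has_derivative_sum) (simp flip: frechet_derivative_works)
  then show ?thesis
    unfolding partial_deriv_def by (simp flip: frechet_derivative_at)
qed

lemma laplacian_partial_deriv:
  assumes "smooth f"
  shows "laplacian (partial_deriv i f) x = partial_deriv i (laplacian f) x"
proof -
  have "laplacian (partial_deriv i f) x
      = (\<Sum>k\<in>UNIV. partial_deriv i (partial_deriv k (partial_deriv k f)) x)"
    unfolding laplacian_eq_sum
    using assms by (simp add: partial_deriv_commute[of _ i] smooth_partial_deriv)
  also have "\<dots> = partial_deriv i (\<lambda>x. \<Sum>k\<in>UNIV. partial_deriv k (partial_deriv k f) x) x"
    using assms by (intro partial_deriv_sum[symmetric])
      (simp add: smooth_imp_differentiable smooth_partial_deriv)
  finally show ?thesis
    by (simp add: laplacian_eq_sum[abs_def])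
qed

lemma
  assumes f: "twice_differentiable f" and g: "twice_differentiable g"
  shows twice_differentiable_diff: "twice_differentiable (\<lambda>x. f x - g x)"
    and laplacian_diff: "laplacian (\<lambda>x. f x - g x) x = laplacian f x - laplacian g x"
    and twice_differentiable_mult: "twice_differentiable (\<lambda>x. f x * g x)"
    and laplacian_mult: "laplacian (\<lambda>x. f x * g x) x = f x * laplacian g x
      + 2 * (\<Sum>i\<in>UNIV. partial_deriv i f x * partial_deriv i g x) + laplacian f x * g x"
proof -
  have d: "f differentiable (at x)" "g differentiable (at x)"
     "partial_deriv i f differentiable (at x)" "partial_deriv i g differentiable (at x)" for i x
    using f g by (auto simp: twice_differentiable_def)
  have diff: "partial_deriv i (\<lambda>x. f x - g x) = (\<lambda>x. partial_deriv i f x - partial_deriv i g x)"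
   and mult: "partial_deriv i (\<lambda>x. f x * g x) = (\<lambda>x. f x * partial_deriv i g x + partial_deriv i f x * g x)" for i
    by (simp_all add: fun_eq_iff partial_deriv_diff partial_deriv_mult d)
  show "twice_differentiable (\<lambda>x. f x - g x)" "twice_differentiable (\<lambda>x. f x * g x)"
    unfolding twice_differentiable_def diff mult by (simp_all add: d)
  show "laplacian (\<lambda>x. f x - g x) x = laplacian f x - laplacian g x"
    unfolding laplacian_eq_sum diff by (simp add: partial_deriv_diff d sum_subtractf)
  show "laplacian (\<lambda>x. f x * g x) x = f x * laplacian g x
      + 2 * (\<Sum>i\<in>UNIV. partial_deriv i f x * partial_deriv i g x) + laplacian f x * g x"
    unfolding laplacian_eq_sum mult
    by (simp add: partial_deriv_add partial_deriv_mult d sum.distrib sum_distrib_left sum_distrib_right algebra_simps)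
qed

section \<open>Second derivatives at a minimum\<close>

lemma DERIV_DERIV_local_min_nonneg:
  fixes g :: "real \<Rightarrow> real"
  assumes g: "\<And>t. (g has_real_derivative g' t) (at t)"
    and g': "(g' has_real_derivative c) (at a)"
    and d: "0 < d" and min: "\<And>t. \<bar>a - t\<bar> < d \<Longrightarrow> g a \<le> g t"
  shows "0 \<le> c"
proof (rule ccontr)
  assume "\<not> 0 \<le> c"
  have "g' a = 0"
    using DERIV_local_min[OF g d] min by blast
  moreover obtain \<delta> where \<delta>: "\<delta> > 0" "\<And>h. 0 < h \<Longrightarrow> h < \<delta> \<Longrightarrow> g' (a + h) < g' a"
    using DERIV_neg_dec_right[OF g'] \<open>\<not> 0 \<le> c\<close> by fastforce
  moreover define h where "h = min d \<delta> / 2"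
  have h: "0 < h" "h < d" "h < \<delta>"
    using d \<delta>(1) by (auto simp: h_def)
  obtain z where z: "a < z" "z < a + h" "g (a + h) - g a = (a + h - a) * g' z"
    using MVT2[of a "a + h" g g'] g h by auto
  ultimately have "g (a + h) < g a"
    using h \<delta>(2)[of "z - a"] mult_pos_neg[of h "g' z"] by simp
  then show False
    using min[of "a + h"] h by simp
qed

text \<open>
  Along a line, \<open>f\<close> minus its tangent has a minimum at the point of tangency, so the second
  derivative test applies.
\<close>

lemma second_dir_deriv_nonneg_if_convex:
  fixes f :: "'a::euclidean_space \<Rightarrow> real"
  assumes conv: "convex_on UNIV f"
    and f: "\<And>x. f differentiable (at x)" and f': "\<And>x. dir_deriv v f differentiable (at x)"
  shows "0 \<le> dir_deriv v (dir_deriv v f) x"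
proof -
  let ?g = "\<lambda>t. f (x + t *\<^sub>R v)" and ?g' = "\<lambda>t. dir_deriv v f (x + t *\<^sub>R v)"
  have g: "(?g has_real_derivative ?g' t) (at t)" for t
    by (rule has_real_derivative_along_line[OF f])
  have "convex_on UNIV ?g"
  proof (rule convex_onI)
    fix s a b :: real assume "0 < s" "s < 1"
    have "x + ((1 - s) *\<^sub>R a + s *\<^sub>R b) *\<^sub>R v = (1 - s) *\<^sub>R (x + a *\<^sub>R v) + s *\<^sub>R (x + b *\<^sub>R v)"
      by (simp add: algebra_simps)
    then show "?g ((1 - s) *\<^sub>R a + s *\<^sub>R b) \<le> (1 - s) * ?g a + s * ?g b"
      using convex_onD[OF conv, of s] \<open>0 < s\<close> \<open>s < 1\<close> by simp
  qed simp
  from convex_on_imp_above_tangent[OF this, of 0] g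
  have tangent: "?g 0 + ?g' 0 * t \<le> ?g t" for t
    by (force simp: algebra_simps)
  have "0 \<le> dir_deriv v (dir_deriv v f) (x + 0 *\<^sub>R v)"
  proof (rule DERIV_DERIV_local_min_nonneg)
    show "((\<lambda>t. ?g t - ?g' 0 * t) has_real_derivative (?g' t - ?g' 0)) (at t)" for t
      by (auto intro!: derivative_eq_intros g)
    show "((\<lambda>t. ?g' t - ?g' 0) has_real_derivative dir_deriv v (dir_deriv v f) (x + 0 *\<^sub>R v)) (at 0)"
      by (auto intro!: derivative_eq_intros has_real_derivative_along_line f')
  qed (use tangent in \<open>auto simp: algebra_simps intro: zero_less_one\<close>)
  then show ?thesis by simp
qed

lemma differentiable_local_min:
  fixes f :: "'a::euclidean_space \<Rightarrow> real"
  assumes f: "f differentiable (at x)"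
    and d: "0 < d" and min: "\<And>t. \<bar>t\<bar> < d \<Longrightarrow> f x \<le> f (x + t *\<^sub>R v)"
  shows "dir_deriv v f x = 0"
  using DERIV_local_min[OF has_real_derivative_along_line[of f x 0 v] d] f min by simp

text \<open>
  If \<open>f\<close> lies locally above a vertical translate of the Gaussian \<open>h\<close> that touches it at \<open>x\<close>, then
  \<open>\<nabla>f = \<nabla>h\<close> and \<open>\<Delta>f \<ge> \<Delta>h\<close> at \<open>x\<close>. The derivatives of \<open>h\<close> are computed along the coordinate lines
  through \<open>x\<close>. For large \<open>\<alpha>\<close> and \<open>x\<close> away from \<open>c\<close>, \<open>\<Delta>h\<close> is of order \<open>\<alpha>\<^sup>2 h\<close> while \<open>\<nabla>h\<close> is only of
  order \<open>\<alpha> h\<close>, which is why the Gaussian serves as a barrier. The case \<open>\<epsilon> = 0\<close> is the usual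
  necessary condition at a local minimum.
\<close>

lemma laplacian_touching_Gaussian:
  fixes f :: "real^'n::finite \<Rightarrow> real" and \<alpha> \<epsilon> :: real and c x :: "real^'n"
  defines "h \<equiv> \<lambda>y. \<epsilon> * exp (- \<alpha> * (dist y c)\<^sup>2)"
  assumes f: "twice_differentiable f" and d: "0 < d"
    and min: "\<And>y. dist x y < d \<Longrightarrow> f x - h x \<le> f y - h y"
  shows "partial_deriv i f x = - 2 * \<alpha> * h x * (x - c) $ i"
    and "h x * (4 * \<alpha>\<^sup>2 * (dist x c)\<^sup>2 - 2 * \<alpha> * CARD('n)) \<le> laplacian f x"
proof -
  have fd: "f differentiable (at x)" "partial_deriv i f differentiable (at x)" for i x
    using f by (auto simp: twice_differentiable_def)
  define N where "N = (dist x c)\<^sup>2"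
  have *: "partial_deriv i f x = - 2 * \<alpha> * h x * (x - c) $ i \<and>
    h x * (4 * \<alpha>\<^sup>2 * ((x - c) $ i)\<^sup>2 - 2 * \<alpha>) \<le> partial_deriv i (partial_deriv i f) x" for i
  proof -
    define n where "n = (x - c) $ i"
    define H where "H = (\<lambda>t. \<epsilon> * exp (- \<alpha> * (N + 2 * t * n + t\<^sup>2)))"
    define H' where "H' = (\<lambda>t. - \<alpha> * (2 * n + 2 * t) * H t)"
    have "(dist (x + t *\<^sub>R axis i 1) c)\<^sup>2 = N + 2 * t * n + t\<^sup>2" for t
    proof -
      have "(dist (x + t *\<^sub>R axis i 1) c)\<^sup>2 = ((x - c) + t *\<^sub>R axis i 1) \<bullet> ((x - c) + t *\<^sub>R axis i 1)"
        by (simp add: dist_norm power2_norm_eq_inner algebra_simps)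
      also have "\<dots> = N + 2 * t * n + t\<^sup>2"
        unfolding N_def n_def dist_norm power2_norm_eq_inner inner_add_left inner_add_right
        by (simp add: inner_axis inner_axis' power2_eq_square algebra_simps)
      finally show ?thesis .
    qed
    then have h: "h (x + t *\<^sub>R axis i 1) = H t" for t
      by (simp add: h_def H_def)
    have H: "(H has_real_derivative H' t) (at t)" for t
      unfolding H'_def H_def by (auto intro!: derivative_eq_intros simp: algebra_simps)
    have H': "(H' has_real_derivative - 2 * \<alpha> * H 0 + (- \<alpha> * (2 * n)) * H' 0) (at 0)"
      unfolding H'_def[abs_def] by (auto intro!: derivative_eq_intros H simp: H'_def algebra_simps)
    let ?f = "\<lambda>t. f (x + t *\<^sub>R axis i 1)" and ?f' = "\<lambda>t. partial_deriv i f (x + t *\<^sub>R axis i 1)"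
    have g: "((\<lambda>t. ?f t - H t) has_real_derivative ?f' t - H' t) (at t)" for t
      by (intro DERIV_diff H) (simp add: partial_deriv_def has_real_derivative_along_line fd)
    have f': "(?f' has_real_derivative partial_deriv i (partial_deriv i f) x) (at 0)"
      using has_real_derivative_along_line[of "partial_deriv i f" x 0 "axis i 1"] fd(2)[of i]
      by (simp add: partial_deriv_def[of i "partial_deriv i f"])
    have m: "?f 0 - H 0 \<le> ?f t - H t" if "\<bar>0 - t\<bar> < d" for t
      using min[of "x + t *\<^sub>R axis i 1"] that h[of t] h[of 0] by (simp add: dist_norm)
    have "?f' 0 - H' 0 = 0"
      using DERIV_local_min[OF g d] m by blast
    moreover have "0 \<le> partial_deriv i (partial_deriv i f) x
        - (- 2 * \<alpha> * H 0 + (- \<alpha> * (2 * n)) * H' 0)"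
      by (rule DERIV_DERIV_local_min_nonneg[OF g DERIV_diff[OF f' H'] d m])
    moreover have "H 0 = h x"
      using h[of 0] by simp
    ultimately show ?thesis
      by (simp add: H'_def n_def power2_eq_square algebra_simps)
  qed
  show "partial_deriv i f x = - 2 * \<alpha> * h x * (x - c) $ i"
    using * by blast
  have "(dist x c)\<^sup>2 = (\<Sum>i\<in>UNIV. ((x - c) $ i)\<^sup>2)"
    unfolding dist_norm power2_norm_eq_inner inner_vec_def by (simp add: power2_eq_square)
  then have "h x * (4 * \<alpha>\<^sup>2 * (dist x c)\<^sup>2 - 2 * \<alpha> * CARD('n))
      = (\<Sum>i\<in>UNIV. h x * (4 * \<alpha>\<^sup>2 * ((x - c) $ i)\<^sup>2 - 2 * \<alpha>))"
    by (simp add: sum_distrib_left sum_subtractf right_diff_distrib mult.assoc)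
  also have "\<dots> \<le> laplacian f x"
    unfolding laplacian_eq_sum using * by (intro sum_mono) blast
  finally show "h x * (4 * \<alpha>\<^sup>2 * (dist x c)\<^sup>2 - 2 * \<alpha> * CARD('n)) \<le> laplacian f x" .
qed

section \<open>A strong minimum principle\<close>

text \<open>
  At every point of \<open>K\<close> one of \<open>f\<close> and \<open>k\<close> is positive, so \<open>max f k\<close> has a positive minimum on \<open>K\<close>; where
  \<open>f\<close> is below that minimum, \<open>k\<close> is not.
\<close>

lemma positive_bound_near_zero_set:
  fixes f k :: "'a::topological_space \<Rightarrow> real"
  assumes K: "compact K" and f: "continuous_on K f" and k: "continuous_on K k"
    and f0: "\<And>x. x \<in> K \<Longrightarrow> 0 \<le> f x" and pos: "\<And>x. x \<in> K \<Longrightarrow> f x = 0 \<Longrightarrow> 0 < k x"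
  obtains \<delta> \<kappa> where "0 < \<delta>" "0 < \<kappa>" "\<And>x. x \<in> K \<Longrightarrow> f x < \<delta> \<Longrightarrow> \<kappa> \<le> k x"
proof (cases "K = {}")
  case True
  then show ?thesis using that[of 1 1] by simp
next
  case False
  have "continuous_on K (\<lambda>x. max (f x) (k x))"
    by (intro continuous_intros f k)
  then obtain a where a: "a \<in> K" "\<And>x. x \<in> K \<Longrightarrow> max (f a) (k a) \<le> max (f x) (k x)"
    using continuous_attains_inf[OF K False] by blast
  have "0 < max (f a) (k a)"
    using f0[OF a(1)] pos[OF a(1)] by (cases "f a = 0") auto
  from this this show ?thesis
  proof (rule that)
    fix x assume "x \<in> K" "f x < max (f a) (k a)"
    then show "max (f a) (k a) \<le> k x"
      using a(2)[of x] by linarith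
  qed
qed

text \<open>
  Let \<open>y\<close> be a point where \<open>f\<close> is positive and \<open>z\<close> a nearest zero, at distance \<open>\<rho>\<close>. On the annulus
  \<open>\<rho>/2 \<le> |x - y| \<le> \<rho>\<close> the function \<open>f\<close> stays above the barrier
  \<open>\<epsilon> (exp (- \<alpha> |x - y|\<^sup>2) - exp (- \<alpha> \<rho>\<^sup>2))\<close>: it does so on the two boundary spheres, and at an interior
  point where \<open>f\<close> minus the barrier had a negative minimum the differential inequality would fail for
  large \<open>\<alpha>\<close>. As the barrier has nonzero
  slope at \<open>z\<close>, so would \<open>f\<close>, although \<open>z\<close> is a minimum. Choosing \<open>\<epsilon>\<close> small confines such a
  point to the region where \<open>f\<close> is small, and there \<open>k\<close> is bounded below by a positive constant; this
  is why \<open>k\<close> need be positive only on the zero set of \<open>f\<close>.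
\<close>

theorem strong_minimum_principle:
  fixes f :: "real^'n::finite \<Rightarrow> real" and L :: "real^'n \<Rightarrow> real^'n"
  assumes f: "twice_differentiable f" and f0: "\<And>x. 0 \<le> f x"
    and k: "continuous_on UNIV k" and L: "continuous_on UNIV L"
    and pos: "\<And>x. f x = 0 \<Longrightarrow> 0 < k x"
    and ineq: "\<And>x. k x * laplacian f x \<le> (\<Sum>i\<in>UNIV. L x $ i * partial_deriv i f x)"
    and zero: "f z0 = 0"
  shows "f y = 0"
proof (rule ccontr)
  assume "f y \<noteq> 0"
  have fd: "f differentiable (at x)" for x
    using f by (auto simp: twice_differentiable_def)
  then have cont: "continuous_on S f" for S
    by (simp add: continuous_at_imp_continuous_on differentiable_imp_continuous_within)
  have "closed {x. f x = 0}"
    using cont[of UNIV] by (intro closed_Collect_eq) auto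
  then obtain z where z: "f z = 0" and near: "\<And>x. f x = 0 \<Longrightarrow> dist y z \<le> dist y x"
  proof -
    have "{x. f x = 0} \<noteq> {}"
      using zero by blast
    then obtain z where "z \<in> {x. f x = 0}" "\<And>x. x \<in> {x. f x = 0} \<Longrightarrow> dist y z \<le> dist y x"
      using distance_attains_inf[OF \<open>closed {x. f x = 0}\<close>] by metis
    then show thesis
      by (intro that) auto
  qed
  define \<rho> where "\<rho> = dist y z"
  have \<rho>: "0 < \<rho>"
    using \<open>f y \<noteq> 0\<close> z by (auto simp: \<rho>_def)
  obtain \<delta> \<kappa> where \<delta>: "0 < \<delta>" and \<kappa>: "0 < \<kappa>"
    and k_lower: "\<And>x. x \<in> cball y \<rho> \<Longrightarrow> f x < \<delta> \<Longrightarrow> \<kappa> \<le> k x"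
    by (rule positive_bound_near_zero_set[of "cball y \<rho>" f k])
       (use f0 pos cont continuous_on_subset[OF k] in auto)
  have "continuous_on (cball y \<rho>) (\<lambda>x. norm (L x))"
    using continuous_on_subset[OF L] by (intro continuous_on_norm) auto
  then have "bounded ((\<lambda>x. norm (L x)) ` cball y \<rho>)"
    by (intro compact_imp_bounded compact_continuous_image) auto
  then obtain M where M: "0 < M" "\<And>x. x \<in> cball y \<rho> \<Longrightarrow> norm (L x) \<le> M"
    unfolding bounded_pos by auto
  obtain m where m: "0 < m" "\<And>x. dist y x \<le> \<rho>/2 \<Longrightarrow> m \<le> f x"
  proof -
    obtain a where a: "a \<in> cball y (\<rho>/2)" "\<And>x. x \<in> cball y (\<rho>/2) \<Longrightarrow> f a \<le> f x"
      using continuous_attains_inf[of "cball y (\<rho>/2)" f] cont \<rho> by force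
    have "f a \<noteq> 0"
    proof
      assume "f a = 0"
      then have "\<rho> \<le> dist y a"
        using near by (simp add: \<rho>_def)
      then show False
        using a(1) \<rho> by simp
    qed
    then show thesis
      using that[of "f a"] f0[of a] a(2) by auto
  qed
  define \<epsilon> where "\<epsilon> = min m \<delta> / 2"
  have \<epsilon>: "0 < \<epsilon>" "\<epsilon> < m" "\<epsilon> < \<delta>"
    using m(1) \<delta> by (auto simp: \<epsilon>_def min_def)
  \<comment> \<open>large enough that \<open>\<kappa> \<Delta>h > M |\<nabla>h|\<close> on the annulus for the Gaussian \<open>h\<close> centred at \<open>y\<close>\<close>
  define \<alpha> where "\<alpha> = (2 * M * \<rho> / \<kappa> + 2 * CARD('n) + 1) / \<rho>\<^sup>2"
  have \<alpha>0: "0 < \<alpha>"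
    using \<rho> M(1) \<kappa> by (auto simp: \<alpha>_def intro!: divide_pos_pos add_nonneg_pos)
  have "\<alpha> * \<rho>\<^sup>2 - 2 * CARD('n) > 2 * M * \<rho> / \<kappa>"
    using \<rho> by (simp add: \<alpha>_def)
  then have \<alpha>: "2 * M * \<rho> < \<kappa> * (\<alpha> * \<rho>\<^sup>2 - 2 * CARD('n))"
    using \<kappa> by (simp add: field_simps)
  define h where "h = (\<lambda>x. \<epsilon> * exp (- \<alpha> * (dist x y)\<^sup>2))"
  define c where "c = \<epsilon> * exp (- \<alpha> * \<rho>\<^sup>2)"
  have h_pos: "0 < h x" and h_le: "h x \<le> \<epsilon>" for x
    using \<epsilon>(1) \<alpha>0 by (auto simp: h_def)
  have c_pos: "0 < c"
    using \<epsilon>(1) by (simp add: c_def)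
  define K where "K = cball y \<rho> - ball y (\<rho>/2)"
  have K: "compact K" "z \<in> K"
    using \<rho> by (auto simp: K_def \<rho>_def compact_diff)
  have barrier: "h x - c \<le> f x" if "x \<in> K" for x
  proof -
    have "continuous_on K (\<lambda>x. f x - h x)"
      unfolding h_def by (intro continuous_intros cont)
    then obtain b where b: "b \<in> K" "\<And>x. x \<in> K \<Longrightarrow> f b - h b \<le> f x - h x"
      using continuous_attains_inf[OF K(1)] K(2) by blast
    have "- c \<le> f b - h b"
    proof (rule ccontr)
      assume neg: "\<not> - c \<le> f b - h b"
      have "dist y b \<noteq> \<rho>"
        using neg f0[of b] by (auto simp: h_def c_def dist_commute)
      moreover have "dist y b \<noteq> \<rho>/2"
        using neg m(2)[of b] h_le[of b] \<epsilon>(2) c_pos by auto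
      ultimately have "b \<in> ball y \<rho> - cball y (\<rho>/2)"
        using b(1) by (auto simp: K_def)
      then obtain d where d: "0 < d" "ball b d \<subseteq> ball y \<rho> - cball y (\<rho>/2)"
        by (meson open_Diff open_ball closed_cball openE)
      have min: "f b - h b \<le> f x - h x" if "dist b x < d" for x
        using d(2) that by (intro b(2)) (auto simp: K_def subset_iff)
      have grad: "\<And>i. partial_deriv i f b = - 2 * \<alpha> * h b * (b - y) $ i"
        and lap: "h b * (4 * \<alpha>\<^sup>2 * (dist b y)\<^sup>2 - 2 * \<alpha> * CARD('n)) \<le> laplacian f b"
        using laplacian_touching_Gaussian[OF f d(1), of b \<epsilon> \<alpha> y] min unfolding h_def by blast+
      have bb: "b \<in> cball y \<rho>" and b\<rho>: "norm (b - y) \<le> \<rho>" "\<rho> / 2 \<le> dist b y"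
        using b(1) by (auto simp: K_def dist_norm norm_minus_commute)
      have "f b < \<delta>"
        using neg c_pos h_le[of b] \<epsilon>(3) by simp
      then have kb: "\<kappa> \<le> k b"
        by (rule k_lower[OF bb])
      have "(\<rho>/2)\<^sup>2 \<le> (dist b y)\<^sup>2"
        using b\<rho>(2) \<rho> by (intro power_mono) auto
      then have "\<alpha> * (\<alpha> * \<rho>\<^sup>2 - 2 * CARD('n)) \<le> 4 * \<alpha>\<^sup>2 * (dist b y)\<^sup>2 - 2 * \<alpha> * CARD('n)"
        using mult_left_mono[of "(\<rho>/2)\<^sup>2" "(dist b y)\<^sup>2" "4 * \<alpha>\<^sup>2"] by (simp add: power2_eq_square field_simps)
      then have lap': "h b * (\<alpha> * (\<alpha> * \<rho>\<^sup>2 - 2 * CARD('n))) \<le> laplacian f b"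
        using lap mult_left_mono[OF _ less_imp_le[OF h_pos[of b]]] by (meson order_trans)
      have "0 < \<alpha> * \<rho>\<^sup>2 - 2 * CARD('n)"
        using \<alpha> M(1) \<rho> \<kappa> by (smt (verit) mult_pos_pos zero_less_mult_pos)
      then have nonneg: "0 \<le> h b * (\<alpha> * (\<alpha> * \<rho>\<^sup>2 - 2 * CARD('n)))"
        using \<alpha>0 h_pos[of b] by simp
      have "(2 * \<alpha> * h b) * (M * \<rho>) = h b * \<alpha> * (2 * M * \<rho>)"
        by simp
      also have "\<dots> < h b * \<alpha> * (\<kappa> * (\<alpha> * \<rho>\<^sup>2 - 2 * CARD('n)))"
        using \<alpha> \<alpha>0 h_pos[of b] by (intro mult_strict_left_mono) auto
      also have "\<dots> = \<kappa> * (h b * (\<alpha> * (\<alpha> * \<rho>\<^sup>2 - 2 * CARD('n))))"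
        by simp
      also have "\<dots> \<le> k b * laplacian f b"
        using kb lap' nonneg \<kappa> by (intro mult_mono) auto
      also have "\<dots> \<le> (\<Sum>i\<in>UNIV. L b $ i * partial_deriv i f b)"
        by (rule ineq)
      also have "\<dots> = (2 * \<alpha> * h b) * (L b \<bullet> (y - b))"
        by (simp add: grad inner_vec_def sum_distrib_left algebra_simps)
      also have "\<dots> \<le> (2 * \<alpha> * h b) * (M * \<rho>)"
      proof (rule mult_left_mono)
        have "L b \<bullet> (y - b) \<le> norm (L b) * norm (b - y)"
          using norm_cauchy_schwarz[of "L b" "y - b"] by (simp add: norm_minus_commute)
        also have "\<dots> \<le> M * \<rho>"
          using M(2)[OF bb] b\<rho>(1) M(1) by (intro mult_mono) auto
        finally show "L b \<bullet> (y - b) \<le> M * \<rho>" .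
      qed (use \<alpha>0 h_pos[of b] in auto)
      finally show False
        by simp
    qed
    then show ?thesis
      using b(2)[OF that] by simp
  qed
  \<comment> \<open>Along the segment from \<open>z\<close> towards \<open>y\<close>, \<open>f\<close> has slope zero at \<open>z\<close> but the barrier has positive
    slope, so \<open>f\<close> drops below the barrier at points of the annulus near \<open>z\<close>.\<close>
  have "dir_deriv (y - z) f z = 0"
    using z f0 by (intro differentiable_local_min[OF fd, of 1]) auto
  then have "((\<lambda>t. f (z + t *\<^sub>R (y - z))) has_real_derivative 0) (at 0)"
    using has_real_derivative_along_line[of f z 0 "y - z"] fd by simp
  then have "((\<lambda>t. f (z + t *\<^sub>R (y - z)) - \<epsilon> * exp (- \<alpha> * ((1 - t) * \<rho>)\<^sup>2)) has_real_derivative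
      - (c * (2 * \<alpha> * \<rho>\<^sup>2))) (at 0)"
    by (auto intro!: derivative_eq_intros simp: c_def power2_eq_square)
  moreover have "- (c * (2 * \<alpha> * \<rho>\<^sup>2)) < 0"
    using c_pos \<alpha>0 \<rho> by simp
  ultimately obtain d where d: "0 < d"
    "\<And>t. 0 < t \<Longrightarrow> t < d \<Longrightarrow> f (z + t *\<^sub>R (y - z)) - \<epsilon> * exp (- \<alpha> * ((1 - t) * \<rho>)\<^sup>2) < - c"
    using DERIV_neg_dec_right[of _ _ 0] z by (force simp: c_def)
  define t where "t = min d 1 / 2"
  have t: "0 < t" "t < d" "t \<le> 1/2"
    using d(1) by (auto simp: t_def)
  define x where "x = z + t *\<^sub>R (y - z)"
  have "y - x = (1 - t) *\<^sub>R (y - z)"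
    by (simp add: x_def algebra_simps)
  then have dist: "dist y x = (1 - t) * \<rho>"
    using t by (simp add: dist_norm \<rho>_def)
  have "\<rho> / 2 \<le> (1 - t) * \<rho>" "(1 - t) * \<rho> \<le> \<rho>"
    using t \<rho> by (auto simp: field_simps)
  then have "x \<in> K"
    by (simp add: K_def dist)
  from barrier[OF this] d(2)[OF t(1,2)] show False
    by (simp add: h_def dist_commute[of _ y] dist flip: x_def)
qed

section \<open>The Hessian of a convex function in the plane\<close>

lemma dir_deriv_plane:
  fixes f :: "real^2 \<Rightarrow> real"
  assumes "f differentiable (at x)"
  shows "dir_deriv (s *\<^sub>R axis 1 1 + t *\<^sub>R axis 2 1) f x = s * partial_deriv 1 f x + t * partial_deriv 2 f x"
proof -
  have "linear (frechet_derivative f (at x))"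
    using assms by (simp add: frechet_derivative_works has_derivative_linear)
  then show ?thesis
    by (simp add: linear_add linear_scale partial_deriv_def)
qed

lemma convex_hessian_form_nonneg:
  fixes u :: "real^2 \<Rightarrow> real"
  assumes u: "smooth u" and conv: "convex_on UNIV u"
  shows "0 \<le> s\<^sup>2 * partial_deriv 1 (partial_deriv 1 u) x
    + 2 * s * t * partial_deriv 1 (partial_deriv 2 u) x + t\<^sup>2 * partial_deriv 2 (partial_deriv 2 u) x"
proof -
  define v :: "real^2" where "v = s *\<^sub>R axis 1 1 + t *\<^sub>R axis 2 1"
  have first: "dir_deriv v f x = s * partial_deriv 1 f x + t * partial_deriv 2 f x" if "smooth f" for f
    unfolding v_def using that by (intro dir_deriv_plane smooth_imp_differentiable)
  have "partial_deriv i (dir_deriv v u) = dir_deriv v (partial_deriv i u)" for i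
    unfolding partial_deriv_eq_dir_deriv using u by (intro dir_deriv_commute) (simp add: smooth_def)
  then have "dir_deriv v (dir_deriv v u) x
      = s * dir_deriv v (partial_deriv 1 u) x + t * dir_deriv v (partial_deriv 2 u) x"
    using first[OF smooth_dir_deriv[OF u]] by simp
  also have "\<dots> = s\<^sup>2 * partial_deriv 1 (partial_deriv 1 u) x
    + 2 * s * t * partial_deriv 1 (partial_deriv 2 u) x + t\<^sup>2 * partial_deriv 2 (partial_deriv 2 u) x"
    using partial_deriv_commute[OF u, of 2 1]
    by (simp add: first u smooth_partial_deriv power2_eq_square algebra_simps)
  finally show ?thesis
    using second_dir_deriv_nonneg_if_convex[OF conv, of v x] u
    by (simp add: smooth_imp_differentiable smooth_dir_deriv)
qed

text \<open>
  The form is tested on \<open>(q, - p)\<close> and \<open>(r, - q)\<close>, where its values are \<open>p\<close> and \<open>r\<close> times the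
  determinant; a positive trace then fixes the sign.
\<close>

lemma nonneg_det_if_nonneg_form:
  fixes p q r :: real
  assumes form: "\<And>s t. 0 \<le> s\<^sup>2 * p + 2 * s * t * q + t\<^sup>2 * r" and tr: "0 < p + r"
  shows "0 \<le> p * r - q * q"
proof -
  have "0 \<le> (p + r) * (p * r - q * q)"
    using form[of q "- p"] form[of r "- q"] by (simp add: power2_eq_square algebra_simps)
  then show ?thesis
    using tr by (simp add: zero_le_mult_iff)
qed

section \<open>The Hessian determinant of a solution\<close>

locale semilinear_plane =
  fixes G :: "real \<Rightarrow> real" and u :: "real^2 \<Rightarrow> real"
  assumes smooth_G: "smooth G" and smooth_u: "smooth u"
    and equation: "\<And>x. laplacian u x = G (u x)"
begin

text \<open>
  By the symmetry of mixed derivatives and the differentiated equation, \<open>b\<close> and \<open>c\<close> determine all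
  third derivatives of \<open>u\<close>.
\<close>

abbreviation "u1 \<equiv> partial_deriv 1 u"
abbreviation "u2 \<equiv> partial_deriv 2 u"
abbreviation "p \<equiv> partial_deriv 1 u1"
abbreviation "q \<equiv> partial_deriv 1 u2"
abbreviation "r \<equiv> partial_deriv 2 u2"
abbreviation "b \<equiv> partial_deriv 1 q"
abbreviation "c \<equiv> partial_deriv 2 q"
abbreviation "G1 \<equiv> \<lambda>x. deriv G (u x)"
abbreviation "G2 \<equiv> \<lambda>x. deriv (deriv G) (u x)"
abbreviation "J \<equiv> \<lambda>x. p x * r x - q x * q x"

lemma smooths: "smooth u1" "smooth u2" "smooth p" "smooth q" "smooth r" "smooth b" "smooth c"
  by (simp_all add: smooth_partial_deriv smooth_u)

lemma det_hessian: "det (hessian u x) = J x"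
  by (simp add: det_2 hessian_def partial_deriv_commute[OF smooth_u, of 2 1])

lemma trace_hessian: "p x + r x = G (u x)"
  using equation[of x] unfolding laplacian_eq_sum sum_2 .

lemma smooth_deriv_G: "smooth (deriv G)"
proof -
  have "deriv G t = dir_deriv 1 G t" for t
  proof -
    have "(G has_real_derivative deriv G t) (at t)"
      using smooth_imp_differentiable[OF smooth_G] DERIV_deriv_iff_real_differentiable by blast
    then show ?thesis
      by (simp add: has_field_derivative_def flip: frechet_derivative_at)
  qed
  then have "deriv G = dir_deriv 1 G"
    by (rule ext)
  then show ?thesis
    using smooth_dir_deriv[OF smooth_G, of 1] by simp
qed

lemma differentiable_G1: "G1 differentiable (at x)"
  using differentiable_compose[of "deriv G" u x UNIV]
    smooth_imp_differentiable[OF smooth_deriv_G] smooth_imp_differentiable[OF smooth_u] by simp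

lemma laplacian_first_derivative: "laplacian (partial_deriv i u) x = G1 x * partial_deriv i u x"
proof -
  have "laplacian u = (\<lambda>x. G (u x))"
    using equation by blast
  then show ?thesis
    using smooth_u smooth_G
    by (simp add: laplacian_partial_deriv partial_deriv_compose smooth_imp_differentiable)
qed

lemma laplacian_second_derivative:
  "laplacian (partial_deriv j (partial_deriv i u)) x
    = G1 x * partial_deriv j (partial_deriv i u) x + G2 x * partial_deriv j u x * partial_deriv i u x"
proof -
  have "laplacian (partial_deriv i u) = (\<lambda>x. G1 x * partial_deriv i u x)"
    using laplacian_first_derivative by blast
  then show ?thesis
    using smooth_u smooth_deriv_G
    by (simp add: laplacian_partial_deriv partial_deriv_compose partial_deriv_mult
        smooth_partial_deriv smooth_imp_differentiable differentiable_G1)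
qed

lemma third_derivatives:
  shows "partial_deriv 1 p x = G1 x * u1 x - c x" and "partial_deriv 2 p x = b x"
    and "partial_deriv 1 r x = c x" and "partial_deriv 2 r x = G1 x * u2 x - b x"
proof -
  have "partial_deriv 2 u1 = q"
    by (rule partial_deriv_commute[OF smooth_u])
  moreover have "partial_deriv 2 p = partial_deriv 1 (partial_deriv 2 u1)"
    by (rule partial_deriv_commute[OF smooths(1)])
  moreover have "partial_deriv 1 r = c"
    by (rule partial_deriv_commute[OF smooths(2)])
  ultimately have *: "partial_deriv 2 u1 = q" "partial_deriv 2 p = b" "partial_deriv 1 r = c"
    by simp_all
  show "partial_deriv 2 p x = b x" "partial_deriv 1 r x = c x"
    by (simp_all add: *)
  show "partial_deriv 1 p x = G1 x * u1 x - c x" "partial_deriv 2 r x = G1 x * u2 x - b x"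
    using laplacian_first_derivative[of 1 x] laplacian_first_derivative[of 2 x] by (simp_all add: laplacian_eq_sum sum_2 *)
qed

lemma twice_differentiable_J: "twice_differentiable J"
  by (rule twice_differentiable_diff; rule twice_differentiable_mult;
      rule smooth_imp_twice_differentiable; rule smooths)

lemma gradient_J:
  shows "partial_deriv 1 J x = G1 x * r x * u1 x + (p x - r x) * c x - 2 * q x * b x"
    and "partial_deriv 2 J x = G1 x * p x * u2 x - (p x - r x) * b x - 2 * q x * c x"
  by (simp_all add: partial_deriv_diff partial_deriv_mult smooth_imp_differentiable smooths
      third_derivatives algebra_simps)

lemma laplacian_J:
  "laplacian J x = 2 * G1 x * J x
     + G2 x * (r x * (u1 x)\<^sup>2 - 2 * q x * u1 x * u2 x + p x * (u2 x)\<^sup>2)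
     + 2 * (G1 x * u1 x * c x + G1 x * u2 x * b x - 2 * (b x)\<^sup>2 - 2 * (c x)\<^sup>2)"
  by (simp add: laplacian_diff laplacian_mult twice_differentiable_mult
      smooth_imp_twice_differentiable smooths laplacian_second_derivative sum_2 third_derivatives
      power2_eq_square algebra_simps)

text \<open>
  With \<open>X = J\<^sub>1 - r G' u\<^sub>1\<close> and \<open>Y = J\<^sub>2 - p G' u\<^sub>2\<close>, the gradient formulas read
  \<open>X = (p - r) c - 2 q b\<close> and \<open>Y = - (p - r) b - 2 q c\<close>. Solving this system for \<open>b\<close> and \<open>c\<close> costs a factor
  \<open>D\<close>, and \<open>D (b\<^sup>2 + c\<^sup>2) = X\<^sup>2 + Y\<^sup>2\<close>. The terms free of \<open>\<nabla>J\<close> combine to a multiple of the form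
  \<open>Q = r u\<^sub>1\<^sup>2 - 2 q u\<^sub>1 u\<^sub>2 + p u\<^sub>2\<^sup>2\<close>; substituting the formulas for \<open>\<nabla>J\<close> turns the claim into a
  polynomial identity.
\<close>

lemma discriminant_laplacian_J:
  "((p x - r x)\<^sup>2 + 4 * (q x)\<^sup>2) * laplacian J x
    = 2 * G1 x * J x * ((p x - r x)\<^sup>2 + 4 * (q x)\<^sup>2)
      + (r x * (u1 x)\<^sup>2 - 2 * q x * u1 x * u2 x + p x * (u2 x)\<^sup>2)
        * (G2 x * ((p x - r x)\<^sup>2 + 4 * (q x)\<^sup>2) - 2 * (p x + r x) * (G1 x)\<^sup>2)
      + 2 * G1 x * ((3 * r x + p x) * u1 x - 2 * q x * u2 x) * partial_deriv 1 J x
      + 2 * G1 x * ((3 * p x + r x) * u2 x - 2 * q x * u1 x) * partial_deriv 2 J x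
      - 4 * ((partial_deriv 1 J x)\<^sup>2 + (partial_deriv 2 J x)\<^sup>2)"
  unfolding laplacian_J gradient_J by (simp add: power2_eq_square algebra_simps)

end

section \<open>Convex solutions\<close>

text \<open>
  The assumption \<open>inverse_convex\<close> says that \<open>1/G\<close> is a convex function.
\<close>

locale convex_semilinear_plane = semilinear_plane +
  assumes convex: "convex_on UNIV u"
    and G_pos: "\<And>t. 0 < G t" and G_decreasing: "\<And>t. deriv G t < 0"
    and inverse_convex: "\<And>t. G t * deriv (deriv G) t \<le> 2 * (deriv G t)\<^sup>2"
begin

lemma J_nonneg: "0 \<le> J x"
  using convex_hessian_form_nonneg[OF smooth_u convex, of _ x] trace_hessian[of x] G_pos[of "u x"]
  by (intro nonneg_det_if_nonneg_form) auto

lemma discriminant_eq: "(p x - r x)\<^sup>2 + 4 * (q x)\<^sup>2 = (G (u x))\<^sup>2 - 4 * J x"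
  unfolding trace_hessian[symmetric] by (simp add: power2_eq_square algebra_simps)

text \<open>
  The term to be estimated in the identity is \<open>Q (G'' D - 2 G (G')\<^sup>2)\<close>, where \<open>0 \<le> D \<le> G\<^sup>2\<close>. If \<open>G'' \<ge> 0\<close>, then
  \<open>G'' D \<le> G'' G\<^sup>2 \<le> 2 (G')\<^sup>2 G\<close>.
\<close>

lemma differential_inequality:
  "((p x - r x)\<^sup>2 + 4 * (q x)\<^sup>2) * laplacian J x
    \<le> 2 * G1 x * J x * ((p x - r x)\<^sup>2 + 4 * (q x)\<^sup>2)
      + 2 * G1 x * ((3 * r x + p x) * u1 x - 2 * q x * u2 x) * partial_deriv 1 J x
      + 2 * G1 x * ((3 * p x + r x) * u2 x - 2 * q x * u1 x) * partial_deriv 2 J x"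
proof -
  define D where "D = (p x - r x)\<^sup>2 + 4 * (q x)\<^sup>2"
  define g where "g = G (u x)"
  have D: "0 \<le> D"
    by (simp add: D_def)
  have D_le: "D \<le> g * g"
    unfolding D_def g_def using J_nonneg[of x] discriminant_eq[of x] by (simp add: power2_eq_square)
  have g: "0 < g"
    by (simp add: g_def G_pos)
  have "G2 x * D \<le> 2 * g * (G1 x)\<^sup>2"
  proof (cases "0 \<le> G2 x")
    case True
    then have "G2 x * D \<le> G2 x * (g * g)"
      by (intro mult_left_mono D_le)
    also have "\<dots> = (g * G2 x) * g"
      by simp
    also have "\<dots> \<le> (2 * (G1 x)\<^sup>2) * g"
      using inverse_convex[of "u x"] g by (intro mult_right_mono) (auto simp: g_def)
    finally show ?thesis by (simp add: mult_ac)
  next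
    case False
    then have "G2 x * D \<le> 0"
      using D by (simp add: mult_nonpos_nonneg)
    also have "0 \<le> 2 * g * (G1 x)\<^sup>2"
      using g by simp
    finally show ?thesis .
  qed
  moreover have "0 \<le> r x * (u1 x)\<^sup>2 - 2 * q x * u1 x * u2 x + p x * (u2 x)\<^sup>2"
    using convex_hessian_form_nonneg[OF smooth_u convex, of "u2 x" x "- u1 x"] by (simp add: mult_ac)
  ultimately have "(r x * (u1 x)\<^sup>2 - 2 * q x * u1 x * u2 x + p x * (u2 x)\<^sup>2)
      * (G2 x * D - 2 * (p x + r x) * (G1 x)\<^sup>2) \<le> 0"
    by (intro mult_nonneg_nonpos) (auto simp: trace_hessian g_def)
  moreover have "0 \<le> 4 * ((partial_deriv 1 J x)\<^sup>2 + (partial_deriv 2 J x)\<^sup>2)"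
    by simp
  ultimately show ?thesis
    unfolding discriminant_laplacian_J D_def by linarith
qed

text \<open>
  At a local minimum with \<open>J > 0\<close> the differential inequality would make \<open>D \<Delta>J\<close> negative. It is void
  when \<open>D = 0\<close>, where the exact formula for \<open>\<Delta>J\<close> has to be used instead.
\<close>

lemma J_zero_at_local_min:
  assumes "local_min_at J x"
  shows "J x = 0"
proof (rule ccontr)
  assume "J x \<noteq> 0"
  then have J_pos: "0 < J x"
    using J_nonneg[of x] by linarith
  obtain d where d: "0 < d" "\<And>y. dist x y < d \<Longrightarrow> J x \<le> J y"
    using assms unfolding local_min_at_def eventually_nhds_metric by (auto simp: dist_commute)
  \<comment> \<open>the case \<open>\<epsilon> = 0\<close>, in which the Gaussian degenerates to the zero function\<close>
  have grad: "partial_deriv 1 J x = 0" "partial_deriv 2 J x = 0" and lap: "0 \<le> laplacian J x"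
    using laplacian_touching_Gaussian[OF twice_differentiable_J d(1), of x 0 0 0] d(2) by auto
  have neg: "2 * G1 x * J x < 0"
    using G_decreasing[of "u x"] J_pos by (simp add: mult_neg_pos)
  show False
  proof (cases "(p x - r x)\<^sup>2 + 4 * (q x)\<^sup>2 = 0")
    case True
    \<comment> \<open>a multiple of the identity as Hessian, so that \<open>\<nabla>J = 0\<close> reduces to \<open>G' p \<nabla>u = 0\<close>\<close>
    then have umbilic: "p x = r x" "q x = 0"
      by (auto simp: add_nonneg_eq_0_iff)
    then have "u1 x = 0" "u2 x = 0"
      using grad J_pos G_decreasing[of "u x"] by (auto simp: gradient_J)
    then have "laplacian J x = 2 * G1 x * J x - 4 * (b x)\<^sup>2 - 4 * (c x)\<^sup>2"
      by (simp add: laplacian_J)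
    also have "\<dots> < 0"
      using neg zero_le_power2[of "b x"] zero_le_power2[of "c x"] by linarith
    finally show False
      using lap by simp
  next
    case False
    then have D: "0 < (p x - r x)\<^sup>2 + 4 * (q x)\<^sup>2"
      using zero_le_power2[of "p x - r x"] zero_le_power2[of "q x"] by linarith
    have "0 \<le> ((p x - r x)\<^sup>2 + 4 * (q x)\<^sup>2) * laplacian J x"
      using D lap by simp
    also have "\<dots> \<le> 2 * G1 x * J x * ((p x - r x)\<^sup>2 + 4 * (q x)\<^sup>2)"
      using differential_inequality[of x] by (simp add: grad)
    also have "\<dots> < 0"
      using neg D by (rule mult_neg_pos)
    finally show False by simp
  qed
qed

text \<open>
  The minimum principle applies with the discriminant as leading coefficient, because it equals
  \<open>G(u)\<^sup>2\<close> where \<open>J = 0\<close>; the term \<open>2 G' J D\<close> has the favourable sign.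
\<close>

lemma J_vanishes_identically:
  assumes "J z = 0"
  shows "J y = 0"
proof -
  define k where "k = (\<lambda>x. (p x - r x)\<^sup>2 + 4 * (q x)\<^sup>2)"
  define L where "L = (\<lambda>x.
    (2 * G1 x * ((3 * r x + p x) * u1 x - 2 * q x * u2 x)) *\<^sub>R axis 1 1 +
    (2 * G1 x * ((3 * p x + r x) * u2 x - 2 * q x * u1 x)) *\<^sub>R axis 2 (1::real) :: real^2)"
  have cont: "continuous_on UNIV u1" "continuous_on UNIV u2" "continuous_on UNIV p"
    "continuous_on UNIV q" "continuous_on UNIV r"
    by (auto intro: smooth_imp_continuous_on smooths)
  have contG1: "continuous_on UNIV G1"
    using differentiable_G1
    by (simp add: continuous_at_imp_continuous_on differentiable_imp_continuous_within)
  show ?thesis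
  proof (rule strong_minimum_principle[OF twice_differentiable_J J_nonneg])
    show "continuous_on UNIV k"
      unfolding k_def by (intro continuous_intros cont)
    show "continuous_on UNIV L"
      unfolding L_def by (intro continuous_intros cont contG1)
    show "0 < k x" if "J x = 0" for x
      using G_pos[of "u x"] discriminant_eq[of x] that by (simp add: k_def)
    show "k x * laplacian J x \<le> (\<Sum>i\<in>UNIV. L x $ i * partial_deriv i J x)" for x
    proof -
      have "2 * G1 x * J x * k x \<le> 0"
        using G_decreasing[of "u x"] J_nonneg[of x]
        by (auto simp: k_def mult_le_0_iff)
      moreover have "L x $ 1 = 2 * G1 x * ((3 * r x + p x) * u1 x - 2 * q x * u2 x)"
        "L x $ 2 = 2 * G1 x * ((3 * p x + r x) * u2 x - 2 * q x * u1 x)"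
        by (simp_all add: L_def axis_def)
      ultimately show ?thesis
        using differential_inequality[of x] unfolding k_def sum_2 by simp
    qed
  qed (rule assms)
qed

end

theorem theorem1p2:
  fixes A :: real and G :: "real \<Rightarrow> real" and u :: "real^2 \<Rightarrow> real"
  assumes "0 < A" and "A \<le> 2"
    and "smooth G"
    and "\<And>t. G t > 0"
    and "\<And>t. deriv G t < 0"
    and "\<And>t. G t * deriv (deriv G) t \<le> A * (deriv G t)\<^sup>2"
    and "smooth u"
    and "convex_on UNIV u"
    and "\<And>x. laplacian u x = G (u x)"
    and "\<exists>x0. local_min_at (\<lambda>x. det (hessian u x)) x0"
  shows "\<forall>x. det (hessian u x) = 0"
proof -
  have "G t * deriv (deriv G) t \<le> 2 * (deriv G t)\<^sup>2" for t
    using assms(6)[of t] mult_right_mono[OF assms(2) zero_le_power2[of "deriv G t"]] by linarith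
  then interpret convex_semilinear_plane G u
    using assms by unfold_locales auto
  obtain x0 where "local_min_at J x0"
    using assms(10) unfolding det_hessian by blast
  then have "J x0 = 0"
    by (rule J_zero_at_local_min)
  then show ?thesis
    unfolding det_hessian by (blast intro: J_vanishes_identically)
qed

end
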